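(* Let $A\in\mathbb{R}^{n\times n}$, $q\in\mathbb{R}^n$, $y^{(0)}\in\mathcal{F}_1$, and let $(\bar x,\bar z_1,\bar z_2,0)\in L\times\{0\}$. Put $\bar w=A\bar x+q$, $\Delta\bar w=\bar w-\bar z_1$ and $\Delta\bar x=\bar x-\bar z_2$. Then the component $\bar x$ gives a solution of $\mathrm{LCP}(q,A)$ if and only if, for every $i\in\{1,\dots,n\}$, $\Delta\bar x_i\,\Delta\bar w_i=0$ or $\bar z_{1i}+\bar z_{2i}>0$.
   Context: $\mathrm{LCP}(q,A)$: find $w,x\in\mathbb{R}^n$ with $w-Ax=q$, $w\ge0$, $x\ge0$, $x^tw=0$; $\bar x$ solves it if $(\bar w,\bar x)$ with $\bar w=A\bar x+q$ satisfies these conditions. Let $\mathcal{F}=\{x\in\mathbb{R}^n : x>0,\ Ax+q>0\}$ (componentwise) and $\mathcal{F}_1=\mathcal{F}\times\mathbb{R}^n_{++}\times\mathbb{R}^n_{++}$, where $\mathbb{R}^n_{++}$ is the set of vectors with all components positive. $A^t$ denotes the transpose of $A$. For $y=(x,z_1,z_2)\in\mathbb{R}^n\times\mathbb{R}^n\times\mathbb{R}^n$, $y^{(0)}=(x^{(0)},z_1^{(0)},z_2^{(0)})\in\mathcal{F}_1$ and $\lambda\in(0,1]$, the homotopy function is $$H(y,y^{(0)},\lambda)=\begin{bmatrix}(1-\lambda)[(A+A^t)x+q-z_1-A^tz_2]+\lambda(x-x^{(0)})\\ Z_1x-\lambda Z_1^{(0)}x^{(0)}\\ Z_2(Ax+q)-\lambda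 Z_2^{(0)}(Ax^{(0)}+q)\end{bmatrix},$$ where $Z_i=\mathrm{diag}(z_i)$ and $Z_i^{(0)}=\mathrm{diag}(z_i^{(0)})$ for $i=1,2$. $\Gamma_y^{(0)}$ is the curve starting from $(y^{(0)},1)$ (the connected component containing $(y^{(0)},1)$) in the zero set $\{(y,\lambda)\in\mathcal{F}_1\times(0,1] : H(y,y^{(0)},\lambda)=0\}$. $L$ is its limit set as $\lambda\to0$: the set of all $\bar y=(\bar x,\bar z_1,\bar z_2)$ such that there are points $(y^k,\lambda^k)\in\Gamma_y^{(0)}$ with $\lambda^k\to0$ and $y^k\to\bar y$. *)

theory Defs
  imports "HOL-Analysis.Analysis"
begin

text \<open>Positivity and nonnegativity of vectors are written out componentwise, because
  \<open><\<close> on \<open>real ^ 'n\<close> is the strict part of the product order and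
  does not mean that all components are strictly ordered.\<close>

definition LCP :: "real ^ 'n \<Rightarrow> real ^ 'n ^ 'n \<Rightarrow> real ^ 'n \<Rightarrow> real ^ 'n \<Rightarrow> bool" where
  "LCP q A w x \<longleftrightarrow>
     w - A *v x = q \<and> (\<forall>i. 0 \<le> w $ i) \<and> (\<forall>i. 0 \<le> x $ i) \<and> x \<bullet> w = 0"

definition solves_LCP :: "real ^ 'n \<Rightarrow> real ^ 'n ^ 'n \<Rightarrow> real ^ 'n \<Rightarrow> bool" where
  "solves_LCP q A x \<longleftrightarrow> LCP q A (A *v x + q) x"

definition pos_vecs :: "(real ^ 'n) set" where
  "pos_vecs = {z. \<forall>i. 0 < z $ i}"

definition feas :: "real ^ 'n ^ 'n \<Rightarrow> real ^ 'n \<Rightarrow> (real ^ 'n) set" where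
  "feas A q = {x. (\<forall>i. 0 < x $ i) \<and> (\<forall>i. 0 < (A *v x + q) $ i)}"

definition feas1 :: "real ^ 'n ^ 'n \<Rightarrow> real ^ 'n \<Rightarrow> ((real ^ 'n) \<times> (real ^ 'n) \<times> (real ^ 'n)) set" where
  "feas1 A q = feas A q \<times> pos_vecs \<times> pos_vecs"

definition diag :: "real ^ 'n \<Rightarrow> real ^ 'n ^ 'n" where
  "diag z = (\<chi> i j. if i = j then z $ i else 0)"

text \<open>The three blocks of the homotopy function are the three components of a nested pair.\<close>

definition homotopy_fun ::
  "real ^ 'n ^ 'n \<Rightarrow> real ^ 'n \<Rightarrow> (real ^ 'n) \<times> (real ^ 'n) \<times> (real ^ 'n) \<Rightarrow>
   (real ^ 'n) \<times> (real ^ 'n) \<times> (real ^ 'n) \<Rightarrow> real \<Rightarrow> (real ^ 'n) \<times> (real ^ 'n) \<times> (real ^ 'n)" where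
  "homotopy_fun A q y y0 l =
     (case y of (x, z1, z2) \<Rightarrow> case y0 of (x0, z10, z20) \<Rightarrow>
       ((1 - l) *\<^sub>R ((A + transpose A) *v x + q - z1 - transpose A *v z2) + l *\<^sub>R (x - x0),
        diag z1 *v x - l *\<^sub>R (diag z10 *v x0),
        diag z2 *v (A *v x + q) - l *\<^sub>R (diag z20 *v (A *v x0 + q))))"

definition homotopy_zeros ::
  "real ^ 'n ^ 'n \<Rightarrow> real ^ 'n \<Rightarrow> (real ^ 'n) \<times> (real ^ 'n) \<times> (real ^ 'n) \<Rightarrow>
   (((real ^ 'n) \<times> (real ^ 'n) \<times> (real ^ 'n)) \<times> real) set" where
  "homotopy_zeros A q y0 =
     {(y, l). y \<in> feas1 A q \<and> l \<in> {0<..1} \<and> homotopy_fun A q y y0 l = 0}"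

definition homotopy_curve ::
  "real ^ 'n ^ 'n \<Rightarrow> real ^ 'n \<Rightarrow> (real ^ 'n) \<times> (real ^ 'n) \<times> (real ^ 'n) \<Rightarrow>
   (((real ^ 'n) \<times> (real ^ 'n) \<times> (real ^ 'n)) \<times> real) set" where
  "homotopy_curve A q y0 = connected_component_set (homotopy_zeros A q y0) (y0, 1)"

definition limit_set ::
  "real ^ 'n ^ 'n \<Rightarrow> real ^ 'n \<Rightarrow> (real ^ 'n) \<times> (real ^ 'n) \<times> (real ^ 'n) \<Rightarrow>
   ((real ^ 'n) \<times> (real ^ 'n) \<times> (real ^ 'n)) set" where
  "limit_set A q y0 =
     {yb. \<exists>(y :: nat \<Rightarrow> (real ^ 'n) \<times> (real ^ 'n) \<times> (real ^ 'n)) l.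
        (\<forall>k. (y k, l k) \<in> homotopy_curve A q y0) \<and> l \<longlonglongrightarrow> 0 \<and> y \<longlonglongrightarrow> yb}"

end

theory Submission
  imports Defs
begin

text \<open>Along the curve all of \<open>x\<close>, \<open>w = A x + q\<close>, \<open>z1\<close>, \<open>z2\<close> are positive, while the
  products \<open>z1\<^sub>i x\<^sub>i\<close> and \<open>z2\<^sub>i w\<^sub>i\<close> are \<open>\<lambda>\<close> times fixed numbers. In the limit \<open>\<lambda> \<rightarrow> 0\<close> the
  four vectors are therefore nonnegative and satisfy \<open>z1\<^sub>i x\<^sub>i = 0\<close> and \<open>z2\<^sub>i w\<^sub>i = 0\<close>
  (\<open>limit_set_complementarity\<close>). Expanding the product and cancelling these two terms gives
  \<open>(x\<^sub>i - z2\<^sub>i) (w\<^sub>i - z1\<^sub>i) = x\<^sub>i w\<^sub>i + z1\<^sub>i z2\<^sub>i\<close>,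
  a sum of two nonnegative numbers, so it vanishes exactly if both summands do. The limit point
  solves the complementarity problem iff \<open>x\<^sub>i w\<^sub>i = 0\<close> for all \<open>i\<close>
  (\<open>solves_LCP_iff_componentwise\<close>), and the criterion reduces to a statement about one
  index: if \<open>x\<^sub>i w\<^sub>i = 0\<close>, the product is \<open>z1\<^sub>i z2\<^sub>i\<close> and can be nonzero only if both factors are
  positive; conversely, a positive \<open>z1\<^sub>i\<close> forces \<open>x\<^sub>i = 0\<close> and a positive \<open>z2\<^sub>i\<close> forces \<open>w\<^sub>i = 0\<close>
  (\<open>complementary_product_iff\<close>).\<close>

lemma diag_mult_component: "(diag z *v x) $ i = z $ i * x $ i"
proof -
  have "(diag z *v x) $ i = (\<Sum>j\<in>UNIV. if i = j then z $ i * x $ j else 0)"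
    unfolding diag_def matrix_vector_mult_def vec_lambda_beta by (intro sum.cong) auto
  then show ?thesis by simp
qed

lemma homotopy_zeros_components:
  assumes "((x, z1, z2), l) \<in> homotopy_zeros A q (x0, z10, z20)"
  shows "0 < x $ i" "0 < (A *v x + q) $ i" "0 < z1 $ i" "0 < z2 $ i"
    and "z1 $ i * x $ i = l * (z10 $ i * x0 $ i)"
    and "z2 $ i * (A *v x + q) $ i = l * (z20 $ i * (A *v x0 + q) $ i)"
proof -
  have "diag z1 *v x = l *\<^sub>R (diag z10 *v x0)"
    and "diag z2 *v (A *v x + q) = l *\<^sub>R (diag z20 *v (A *v x0 + q))"
    using assms by (auto simp: homotopy_zeros_def homotopy_fun_def zero_prod_def)
  then have "(diag z1 *v x) $ i = (l *\<^sub>R (diag z10 *v x0)) $ i"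
    and "(diag z2 *v (A *v x + q)) $ i = (l *\<^sub>R (diag z20 *v (A *v x0 + q))) $ i"
    by simp_all
  then show "z1 $ i * x $ i = l * (z10 $ i * x0 $ i)"
    and "z2 $ i * (A *v x + q) $ i = l * (z20 $ i * (A *v x0 + q) $ i)"
    by (simp_all only: vector_scaleR_component diag_mult_component real_scaleR_def)
  show "0 < x $ i" "0 < (A *v x + q) $ i" "0 < z1 $ i" "0 < z2 $ i"
    using assms unfolding homotopy_zeros_def feas1_def feas_def pos_vecs_def by auto
qed

text \<open>Strict inequalities become weak ones in the limit, and the right-hand sides of the
  product equations tend to \<open>0\<close> with \<open>\<lambda>\<close>.\<close>

lemma limit_set_complementarity:
  assumes "(x, z1, z2) \<in> limit_set A q y0"
  shows "0 \<le> x $ i" "0 \<le> (A *v x + q) $ i" "0 \<le> z1 $ i" "0 \<le> z2 $ i"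
    and "z1 $ i * x $ i = 0" "z2 $ i * (A *v x + q) $ i = 0"
proof -
  obtain x0 z10 z20 where y0: "y0 = (x0, z10, z20)" by (cases y0)
  from assms obtain y l where curve: "\<And>k. (y k, l k) \<in> homotopy_curve A q y0"
    and l: "l \<longlonglongrightarrow> 0" and y: "y \<longlonglongrightarrow> (x, z1, z2)"
    unfolding limit_set_def by auto
  define X Z1 Z2 where "X k = fst (y k)" and "Z1 k = fst (snd (y k))" and "Z2 k = snd (snd (y k))" for k
  have "((X k, Z1 k, Z2 k), l k) \<in> homotopy_zeros A q (x0, z10, z20)" for k
    using curve[of k] connected_component_subset
    unfolding homotopy_curve_def y0 X_def Z1_def Z2_def by fastforce
  note zeros = homotopy_zeros_components[OF this, of _ i]
  have "X \<longlonglongrightarrow> x" "Z1 \<longlonglongrightarrow> z1" "Z2 \<longlonglongrightarrow> z2"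
    using tendsto_fst[OF y] tendsto_fst[OF tendsto_snd[OF y]] tendsto_snd[OF tendsto_snd[OF y]]
    by (simp_all add: X_def[abs_def] Z1_def[abs_def] Z2_def[abs_def])
  then have lims: "(\<lambda>k. X k $ i) \<longlonglongrightarrow> x $ i" "(\<lambda>k. Z1 k $ i) \<longlonglongrightarrow> z1 $ i" "(\<lambda>k. Z2 k $ i) \<longlonglongrightarrow> z2 $ i"
    by (auto intro: tendsto_vec_nth)
  have "(\<lambda>k. A *v X k + q) \<longlonglongrightarrow> A *v x + q"
    using \<open>X \<longlonglongrightarrow> x\<close>
    by (intro tendsto_add tendsto_const bounded_linear.tendsto[OF matrix_vector_mul_bounded_linear])
  then have limw: "(\<lambda>k. (A *v X k + q) $ i) \<longlonglongrightarrow> (A *v x + q) $ i"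
    by (rule tendsto_vec_nth)
  show "0 \<le> x $ i" "0 \<le> (A *v x + q) $ i" "0 \<le> z1 $ i" "0 \<le> z2 $ i"
    using lims limw zeros(1-4) by (meson LIMSEQ_le_const less_imp_le)+
  have vanish: "(\<lambda>k. l k * c) \<longlonglongrightarrow> 0" for c
    using tendsto_mult_right[OF l, of c] by simp
  show "z1 $ i * x $ i = 0"
  proof (rule LIMSEQ_unique)
    show "(\<lambda>k. Z1 k $ i * X k $ i) \<longlonglongrightarrow> z1 $ i * x $ i"
      by (intro tendsto_mult lims)
    show "(\<lambda>k. Z1 k $ i * X k $ i) \<longlonglongrightarrow> 0"
      unfolding zeros(5) by (rule vanish)
  qed
  show "z2 $ i * (A *v x + q) $ i = 0"
  proof (rule LIMSEQ_unique)
    show "(\<lambda>k. Z2 k $ i * (A *v X k + q) $ i) \<longlonglongrightarrow> z2 $ i * (A *v x + q) $ i"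
      by (intro tendsto_mult lims limw)
    show "(\<lambda>k. Z2 k $ i * (A *v X k + q) $ i) \<longlonglongrightarrow> 0"
      unfolding zeros(6) by (rule vanish)
  qed
qed

text \<open>An inner product of nonnegative vectors is a sum of nonnegative terms, hence zero only if
  every term is.\<close>

lemma solves_LCP_iff_componentwise:
  assumes "\<And>i. 0 \<le> x $ i" "\<And>i. 0 \<le> (A *v x + q) $ i"
  shows "solves_LCP q A x \<longleftrightarrow> (\<forall>i. x $ i * (A *v x + q) $ i = 0)"
proof -
  have "x \<bullet> (A *v x + q) = 0 \<longleftrightarrow> (\<forall>i. x $ i * (A *v x + q) $ i = 0)"
    unfolding inner_vec_def inner_real_def
    by (subst sum_nonneg_eq_0_iff) (use assms in \<open>auto simp del: vector_add_component mult_eq_0_iff\<close>)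
  then show ?thesis
    using assms unfolding solves_LCP_def LCP_def by (auto simp del: vector_add_component)
qed

lemma complementary_product_iff:
  fixes x w a b :: real
  assumes nonneg: "0 \<le> x" "0 \<le> w" "0 \<le> a" "0 \<le> b" and compl: "a * x = 0" "b * w = 0"
  shows "x * w = 0 \<longleftrightarrow> (x - b) * (w - a) = 0 \<or> 0 < a + b"
proof -
  have "(x - b) * (w - a) = x * w + a * b"
    using compl by algebra
  then have "(x - b) * (w - a) = 0 \<longleftrightarrow> x * w = 0 \<and> a * b = 0"
    using nonneg by (simp only: add_nonneg_eq_0_iff mult_nonneg_nonneg)
  then show ?thesis
    using nonneg compl by (smt (verit) mult_eq_0_iff)
qed

theorem theorem3p6:
  fixes A :: "real ^ 'n ^ 'n" and q :: "real ^ 'n"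
    and y0 :: "(real ^ 'n) \<times> (real ^ 'n) \<times> (real ^ 'n)"
    and xb z1b z2b wb dw dx :: "real ^ 'n"
  assumes "y0 \<in> feas1 A q"
    and "((xb, z1b, z2b), 0) \<in> limit_set A q y0 \<times> {0::real}"
    and "wb = A *v xb + q"
    and "dw = wb - z1b"
    and "dx = xb - z2b"
  shows "solves_LCP q A xb \<longleftrightarrow> (\<forall>i. dx $ i * dw $ i = 0 \<or> z1b $ i + z2b $ i > 0)"
proof -
  have "(xb, z1b, z2b) \<in> limit_set A q y0"
    using assms(2) by simp
  note limit = limit_set_complementarity[OF this, folded assms(3)]
  have "solves_LCP q A xb \<longleftrightarrow> (\<forall>i. xb $ i * wb $ i = 0)"
    using solves_LCP_iff_componentwise[of xb A q] limit(1,2) unfolding assms(3) by blast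
  also have "\<dots> \<longleftrightarrow> (\<forall>i. (xb $ i - z2b $ i) * (wb $ i - z1b $ i) = 0 \<or> 0 < z1b $ i + z2b $ i)"
    using complementary_product_iff[OF limit] by blast
  finally show ?thesis
    unfolding assms(4,5) by simp
qed

end
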